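(* Let $G$ be a connected graph of order $n\geqslant 3$ which is not a cycle. Then $$D'(G^{\frac{1}{2}})\leqslant \left\lceil \frac{-1+\sqrt{1+8D'(G)}}{2}\right\rceil.$$
   Context: Graphs are finite and simple. $G^{\frac{1}{2}}$ is obtained from $G$ by replacing each edge $uv$ by a path $u\,w\,v$ of length 2 through a new vertex $w$. The distinguishing index $D'(H)$ is the least $d$ such that some edge labeling $E(H)\to\{1,\dots,d\}$ is preserved by no non-trivial automorphism of $H$. *)

theory Defs
  imports Complex_Main
begin

record 'a graph =
  verts :: "'a set"
  edges :: "'a set set"

definition simple_graph :: "'a graph \<Rightarrow> bool" where
  "simple_graph G \<longleftrightarrow> finite (verts G) \<and> (\<forall>e\<in>edges G. e \<subseteq> verts G \<and> card e = 2)"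

definition connected_graph :: "'a graph \<Rightarrow> bool" where
  "connected_graph G \<longleftrightarrow> verts G \<noteq> {} \<and>
     (\<forall>u\<in>verts G. \<forall>v\<in>verts G. (u, v) \<in> {(x, y). {x, y} \<in> edges G}\<^sup>*)"

definition cycle_graph :: "'a graph \<Rightarrow> bool" where
  "cycle_graph G \<longleftrightarrow> (\<exists>xs. length xs \<ge> 3 \<and> distinct xs \<and> verts G = set xs \<and>
     edges G = {{xs ! i, xs ! (Suc i mod length xs)} | i. i < length xs})"

text \<open>The half power: the new vertex in the middle of the edge \<open>e\<close> is \<open>Inr e\<close>, so the edge
  \<open>{u, v}\<close> becomes the path \<open>Inl u\<close>, \<open>Inr {u, v}\<close>, \<open>Inl v\<close>.\<close>

definition half_power :: "'a graph \<Rightarrow> ('a + 'a set) graph" where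
  "half_power G = \<lparr>verts = Inl ` verts G \<union> Inr ` edges G,
                   edges = {{Inl v, Inr e} | v e. e \<in> edges G \<and> v \<in> e}\<rparr>"

text \<open>Only the values of an automorphism on the vertex set matter; non-triviality is therefore
  also judged there.\<close>

definition graph_automorphism :: "'a graph \<Rightarrow> ('a \<Rightarrow> 'a) \<Rightarrow> bool" where
  "graph_automorphism G f \<longleftrightarrow> bij_betw f (verts G) (verts G) \<and>
     (\<forall>u\<in>verts G. \<forall>v\<in>verts G. {u, v} \<in> edges G \<longleftrightarrow> {f u, f v} \<in> edges G)"

definition preserves_labeling :: "'a graph \<Rightarrow> ('a set \<Rightarrow> nat) \<Rightarrow> ('a \<Rightarrow> 'a) \<Rightarrow> bool" where
  "preserves_labeling G c f \<longleftrightarrow> (\<forall>e\<in>edges G. c (f ` e) = c e)"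

definition distinguishing_labeling :: "'a graph \<Rightarrow> nat \<Rightarrow> ('a set \<Rightarrow> nat) \<Rightarrow> bool" where
  "distinguishing_labeling G d c \<longleftrightarrow> c ` edges G \<subseteq> {1..d} \<and>
     \<not> (\<exists>f. graph_automorphism G f \<and> (\<exists>v\<in>verts G. f v \<noteq> v) \<and> preserves_labeling G c f)"

text \<open>The least value is meaningful for every connected simple graph with at least three
  vertices: an injective edge labeling is distinguishing there. It is unspecified when no
  distinguishing edge labeling exists, as for the graph with two vertices and one edge.\<close>

definition distinguishing_index :: "'a graph \<Rightarrow> nat" where
  "distinguishing_index G = (LEAST d. \<exists>c. distinguishing_labeling G d c)"

end

theory Submission
  imports Defs
begin

text \<open>With \<open>k\<close> the right-hand side, \<open>k (k + 1) / 2 \<ge> D'(G)\<close>, so the colours of an optimal labeling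
  of \<open>G\<close> can be encoded as unordered pairs (repetition allowed) of labels from \<open>{1..k}\<close>; the two
  halves of each edge get the two members of its pair, in any order. The half power is a connected
  bipartite graph, so an automorphism either preserves the two sides or exchanges them.
  If it preserves them, it induces an automorphism of \<open>G\<close> that preserves the colouring and is
  therefore trivial. If it exchanges them, every vertex of \<open>G\<close> has degree 2, like the
  subdivision vertices, so the connected graph \<open>G\<close> is a cycle.\<close>

section \<open>Edges and connectedness\<close>

lemma simple_graph_edgeE:
  assumes "simple_graph G" "e \<in> edges G"
  obtains u v where "e = {u, v}" "u \<noteq> v" "u \<in> verts G" "v \<in> verts G"
proof -
  have "e \<subseteq> verts G" "card e = 2"
    using assms unfolding simple_graph_def by auto
  then show thesis
    using that unfolding card_2_iff by auto
qed

lemma simple_graph_edgeD: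
  assumes "simple_graph G" "{u, v} \<in> edges G"
  shows "u \<noteq> v" "u \<in> verts G" "v \<in> verts G"
  using assms unfolding simple_graph_def by (auto simp: card_insert_if split: if_splits)

lemma simple_graph_edge_eqI:
  assumes "simple_graph G" "e \<in> edges G" "u \<in> e" "v \<in> e" "u \<noteq> v"
  shows "e = {u, v}"
proof -
  obtain x y where "e = {x, y}"
    using simple_graph_edgeE[OF assms(1,2)] .
  then show ?thesis using assms(3-5) by auto
qed

text \<open>Connectedness as an invariance principle, by induction along a walk. Below,
  \<open>S\<close> is a single vertex or two swapped vertices, the vertex set of a longest path, or
  the set of vertices sent to the other side.\<close>

lemma connected_graph_closed:
  assumes "connected_graph G" "u \<in> verts G" "u \<in> S"
    and closed: "\<And>x y. x \<in> S \<Longrightarrow> {x, y} \<in> edges G \<Longrightarrow> y \<in> S"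
  shows "verts G \<subseteq> S"
proof
  fix v assume "v \<in> verts G"
  then have "(u, v) \<in> {(x, y). {x, y} \<in> edges G}\<^sup>*"
    using assms(1,2) unfolding connected_graph_def by blast
  then show "v \<in> S"
  proof induction
    case base
    show ?case by (rule assms(3))
  next
    case (step y z)
    then show ?case using closed by blast
  qed
qed

lemma connected_graph_neighbour_outside:
  assumes "connected_graph G" "finite S" "card S < card (verts G)" "u \<in> verts G" "u \<in> S"
  shows "\<exists>x\<in>S. \<exists>y. y \<notin> S \<and> {x, y} \<in> edges G"
proof (rule ccontr)
  assume none: "\<not> ?thesis"
  have "verts G \<subseteq> S"
    by (rule connected_graph_closed[OF assms(1,4,5)]) (use none in blast)
  then have "card (verts G) \<le> card S"
    using card_mono[OF assms(2)] by blast
  then show False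
    using assms(3) by simp
qed

section \<open>Existence of distinguishing labelings\<close>

text \<open>Labels identify edges, so a label-preserving automorphism maps each edge to itself. A
  moved vertex \<open>v\<close> therefore changes places with a neighbour \<open>w\<close>. With
  three vertices, connectedness supplies an edge leaving \<open>{v, w}\<close>, and that edge cannot
  be mapped to itself.\<close>

lemma injective_labeling_distinguishing:
  assumes G: "simple_graph G" "connected_graph G" "card (verts G) \<ge> 3"
    and c: "inj_on c (edges G)" "c ` edges G \<subseteq> {1..d}"
  shows "distinguishing_labeling G d c"
  unfolding distinguishing_labeling_def
proof (intro conjI notI c(2))
  assume "\<exists>f. graph_automorphism G f \<and> (\<exists>v\<in>verts G. f v \<noteq> v) \<and> preserves_labeling G c f"
  then obtain f v where f: "graph_automorphism G f" "preserves_labeling G c f"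
    and v: "v \<in> verts G" "f v \<noteq> v" by blast
  have fixe: "{f x, f y} = {x, y}" if "{x, y} \<in> edges G" for x y
  proof -
    have "{f x, f y} \<in> edges G"
      using f(1) that simple_graph_edgeD[OF G(1) that] unfolding graph_automorphism_def by blast
    moreover have "c {f x, f y} = c {x, y}"
      using f(2) that unfolding preserves_labeling_def by fastforce
    ultimately show ?thesis
      using c(1) that by (auto dest: inj_onD)
  qed
  obtain w where w: "{v, w} \<in> edges G" "w \<noteq> v"
    using connected_graph_neighbour_outside[OF G(2), of "{v}" v] v G(3) by force
  then have swap: "f v = w" "f w = v"
    using fixe[OF w(1)] v(2) by (auto simp: doubleton_eq_iff)
  have "card {v, w} < card (verts G)"
    using G(3) w(2) by simp
  then obtain x y where "x \<in> {v, w}" "y \<notin> {v, w}" "{x, y} \<in> edges G"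
    using connected_graph_neighbour_outside[OF G(2), of "{v, w}" v] v by blast
  then show False
    using fixe[of x y] swap w(2) by (auto simp: doubleton_eq_iff)
qed

text \<open>\<open>LEAST\<close> says something only once some labeling exists; a numbering of the
  finitely many edges provides one.\<close>

lemma distinguishing_index_attained:
  assumes G: "simple_graph G" "connected_graph G" "card (verts G) \<ge> 3"
  obtains c where "distinguishing_labeling G (distinguishing_index G) c"
proof -
  have "edges G \<subseteq> Pow (verts G)" "finite (verts G)"
    using G(1) unfolding simple_graph_def by auto
  then have "finite (edges G)"
    by (meson finite_Pow_iff finite_subset)
  then obtain h where h: "bij_betw h (edges G) {0..<card (edges G)}"
    using ex_bij_betw_finite_nat by blast
  \<comment> \<open>\<open>Suc\<close> because \<open>h\<close> numbers the edges from 0, while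
    labels start at 1.\<close>
  then have "distinguishing_labeling G (card (edges G)) (Suc \<circ> h)"
    by (intro injective_labeling_distinguishing G)
      (auto simp: bij_betw_def inj_on_def Suc_le_eq)
  then have "\<exists>d c. distinguishing_labeling G d c" by blast
  then have "\<exists>c. distinguishing_labeling G (distinguishing_index G) c"
    unfolding distinguishing_index_def by (rule LeastI_ex)
  then show thesis using that by blast
qed

section \<open>Connected graphs with all degrees 2\<close>

text \<open>Counting incident edges counts neighbours, since an edge at \<open>v\<close> is
  determined by its other end.\<close>

lemma degree_two_neighbours:
  assumes G: "simple_graph G" and v: "card {e \<in> edges G. v \<in> e} = 2"
  obtains a b where "a \<noteq> b" "\<And>x. {v, x} \<in> edges G \<longleftrightarrow> x = a \<or> x = b"
proof -
  obtain e f where ef: "{e \<in> edges G. v \<in> e} = {e, f}" "e \<noteq> f"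
    using v unfolding card_2_iff by auto
  have incident: "g \<in> edges G \<and> v \<in> g \<longleftrightarrow> g = e \<or> g = f" for g
    using ef(1) by (auto simp: set_eq_iff)
  have other_end: "\<exists>a. g = {v, a}" if g: "g \<in> edges G" "v \<in> g" for g
  proof -
    obtain x y where "g = {x, y}"
      using simple_graph_edgeE[OF G g(1)] .
    then have "g = {v, x} \<or> g = {v, y}" using g(2) by auto
    then show ?thesis by blast
  qed
  obtain a where a: "e = {v, a}" using other_end[of e] incident[of e] by auto
  obtain b where b: "f = {v, b}" using other_end[of f] incident[of f] by auto
  have "a \<noteq> b" using ef(2) a b by blast
  moreover have "{v, x} \<in> edges G \<longleftrightarrow> x = a \<or> x = b" for x
    using incident[of "{v, x}"] unfolding a b by (auto simp: doubleton_eq_iff)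
  ultimately show thesis using that by blast
qed

text \<open>A longest path closes up to a cycle: the second neighbour of its last vertex lies on it, and
  the inner vertices already have both of their neighbours on the path.\<close>

lemma connected_two_regular_cycle_graph:
  assumes G: "simple_graph G" "connected_graph G"
    and deg: "\<And>v. v \<in> verts G \<Longrightarrow> card {e \<in> edges G. v \<in> e} = 2"
  shows "cycle_graph G"
proof -
  note nbr = degree_two_neighbours[OF G(1) deg]
  have other: "\<exists>x. x \<noteq> w \<and> {v, x} \<in> edges G" if "v \<in> verts G" for v w
    using nbr[OF that] by metis
  \<comment> \<open>The form in which degree 2 is used below: three different neighbours of one
    vertex are a contradiction.\<close>
  have three: "a = b \<or> a = x \<or> b = x"
    if "{v, a} \<in> edges G" "{v, b} \<in> edges G" "{v, x} \<in> edges G" for v a b x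
  proof -
    have "v \<in> verts G" using simple_graph_edgeD(2)[OF G(1) that(1)] .
    then obtain y z where "\<And>x. {v, x} \<in> edges G \<longleftrightarrow> x = y \<or> x = z"
      using nbr[of v] by metis
    then have "a = y \<or> a = z" "b = y \<or> b = z" "x = y \<or> x = z" using that by simp_all
    then show ?thesis by blast
  qed
  define P where "P xs \<longleftrightarrow> distinct xs \<and> set xs \<subseteq> verts G \<and>
    (\<forall>i. Suc i < length xs \<longrightarrow> {xs ! i, xs ! Suc i} \<in> edges G)" for xs
  have fin: "finite (verts G)" using G(1) unfolding simple_graph_def by blast
  have bound: "length xs \<le> card (verts G)" if "P xs" for xs
    using that card_mono[OF fin, of "set xs"] distinct_card[of xs] unfolding P_def by simp
  obtain v where v: "v \<in> verts G" using G(2) unfolding connected_graph_def by blast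
  obtain a where a: "{v, a} \<in> edges G" using other[OF v] by blast
  obtain b where "b \<noteq> a" "{v, b} \<in> edges G" using other[OF v] by blast
  with a have ab: "a \<noteq> b" "{v, a} \<in> edges G" "{v, b} \<in> edges G" by simp_all
  \<comment> \<open>A path on three vertices, so that a longest path has \<open>n \<ge> 3\<close>:
    positions \<open>n - 1\<close> and \<open>n - 2\<close> are then different, and so are the two
    cyclic neighbours of a position.\<close>
  have P3: "P [a, v, b]"
    using ab simple_graph_edgeD[OF G(1) ab(2)] simple_graph_edgeD[OF G(1) ab(3)]
    unfolding P_def by (auto simp: less_Suc_eq insert_commute)
  have "\<exists>xs. P xs \<and> (\<forall>ys. P ys \<longrightarrow> length ys \<le> length xs)"
    using P3 bound by (intro ex_has_greatest_nat[of P "[a, v, b]" _ "Suc (card (verts G))"])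
      (auto simp: less_Suc_eq_le)
  then obtain xs where xs: "P xs" and max: "\<And>ys. P ys \<Longrightarrow> length ys \<le> length xs"
    by metis
  define n where "n = length xs"
  have n3: "n \<ge> 3" using max[OF P3] by (simp add: n_def)
  have dist: "distinct xs" and sub: "set xs \<subseteq> verts G"
    and path: "\<And>i. Suc i < n \<Longrightarrow> {xs ! i, xs ! Suc i} \<in> edges G"
    using xs unfolding P_def n_def by auto
  have inV: "xs ! i \<in> verts G" if "i < n" for i
    using that sub unfolding n_def by auto
  have neq: "xs ! i = xs ! j \<longleftrightarrow> i = j" if "i < n" "j < n" for i j
    using that dist nth_eq_iff_index_eq unfolding n_def by blast
  obtain y where y: "y \<noteq> xs ! (n - 2)" "{xs ! (n - 1), y} \<in> edges G"
    using other[OF inV[of "n - 1"], of "xs ! (n - 2)"] n3 by auto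
  \<comment> \<open>Otherwise appending \<open>y\<close> would give a longer path.\<close>
  have "y \<in> set xs"
  proof (rule ccontr)
    assume "y \<notin> set xs"
    moreover have "{(xs @ [y]) ! i, (xs @ [y]) ! Suc i} \<in> edges G" if "Suc i < Suc n" for i
    proof (cases "Suc i < n")
      case True
      then show ?thesis using path[OF True] by (simp add: nth_append n_def)
    next
      case False
      then have "Suc i = length xs" "i = n - 1" using that unfolding n_def by simp_all
      then have "(xs @ [y]) ! Suc i = y" "(xs @ [y]) ! i = xs ! (n - 1)"
        by (simp_all add: nth_append)
      then show ?thesis using y(2) by simp
    qed
    ultimately have "P (xs @ [y])"
      using dist sub simple_graph_edgeD[OF G(1) y(2)] unfolding P_def by (auto simp: n_def)
    from max[OF this] show False by simp
  qed
  then obtain j where j: "j < n" "y = xs ! j" unfolding n_def in_set_conv_nth by blast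
  \<comment> \<open>Were \<open>y\<close> an inner vertex, its predecessor, its successor and the
    last vertex would be three different neighbours. Positions \<open>n - 1\<close> and
    \<open>n - 2\<close> are excluded by the absence of loops and by the choice of
    \<open>y\<close>.\<close>
  have "j = 0"
  proof (rule ccontr)
    assume j0: "j \<noteq> 0"
    have "j \<noteq> n - 1" "j \<noteq> n - 2"
      using y simple_graph_edgeD(1)[OF G(1) y(2)] j by auto
    then have jn: "Suc j < n - 1" using j(1) by simp
    have "{xs ! j, xs ! (j - 1)} \<in> edges G" "{xs ! j, xs ! Suc j} \<in> edges G"
      "{xs ! j, xs ! (n - 1)} \<in> edges G"
      using path[of "j - 1"] path[of j] jn j0 y(2) j(2) by (simp_all add: insert_commute)
    from three[OF this] have "j - 1 = Suc j \<or> j - 1 = n - 1 \<or> Suc j = n - 1"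
      using jn by (simp add: neq)
    then show False using jn j0 by auto
  qed
  define s where "s i = Suc i mod n" for i
  have s_eq: "s i = (if i = n - 1 then 0 else Suc i)" if "i < n" for i
    using that n3 unfolding s_def by auto
  have s_lt: "s i < n" for i using n3 unfolding s_def by simp
  have cyc: "{xs ! i, xs ! s i} \<in> edges G" if "i < n" for i
    using that path[of i] y(2) j(2) \<open>j = 0\<close> by (auto simp: s_eq)
  \<comment> \<open>The cyclic predecessor \<open>p\<close> and successor \<open>s i\<close> of
    position \<open>i\<close> use up the degree of \<open>u\<close>, so an edge at \<open>u\<close>
    is neither a chord nor a way out of the cycle.\<close>
  have step: "\<exists>k<n. {u, w} = {xs ! k, xs ! s k}" if "u = xs ! i" "i < n" "{u, w} \<in> edges G" for u w i
  proof -
    define p where "p = (if i = 0 then n - 1 else i - 1)"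
    have p: "p < n" "s p = i" "p \<noteq> s i"
      using that(2) n3 by (auto simp: p_def s_eq)
    have "xs ! s i = xs ! p \<or> xs ! s i = w \<or> xs ! p = w"
      using three[of u "xs ! s i" "xs ! p" w] cyc[OF that(2)] cyc[OF p(1)] that p(2)
      by (simp add: insert_commute)
    then have "w = xs ! s i \<or> w = xs ! p"
      using neq[OF s_lt p(1)] p(3) by auto
    then show ?thesis
      using that p by (metis insert_commute)
  qed
  have closed: "y \<in> set xs" if x: "x \<in> set xs" "{x, y} \<in> edges G" for x y
  proof -
    obtain i where "x = xs ! i" "i < n" using x(1) unfolding n_def in_set_conv_nth by blast
    then obtain k where "k < n" "{x, y} = {xs ! k, xs ! s k}" using step x(2) by blast
    then show ?thesis using s_lt[of k] unfolding n_def
      by (metis doubleton_eq_iff nth_mem)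
  qed
  have "verts G \<subseteq> set xs"
  proof (rule connected_graph_closed[OF G(2)])
    show "xs ! 0 \<in> verts G" "xs ! 0 \<in> set xs" using inV[of 0] nth_mem[of 0 xs] n3 unfolding n_def by linarith+
  qed (use closed in blast)
  then have V: "verts G = set xs" using sub by blast
  have "e \<in> {{xs ! i, xs ! s i} | i. i < n}" if e: "e \<in> edges G" for e
  proof -
    obtain u w where "e = {u, w}" "u \<in> verts G"
      using simple_graph_edgeE[OF G(1) e] by metis
    moreover from this obtain i where "u = xs ! i" "i < n"
      unfolding V n_def in_set_conv_nth by blast
    ultimately show ?thesis using step[of u i w] e by blast
  qed
  then have "edges G = {{xs ! i, xs ! s i} | i. i < n}" using cyc by blast
  then show ?thesis
    using V dist n3 unfolding cycle_graph_def s_def n_def by blast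
qed

section \<open>The half power and its automorphisms\<close>

lemma verts_half_power [simp]:
  "Inl v \<in> verts (half_power G) \<longleftrightarrow> v \<in> verts G"
  "Inr e \<in> verts (half_power G) \<longleftrightarrow> e \<in> edges G"
  unfolding half_power_def by auto

lemma edges_half_power [simp]:
  "{Inl v, Inr e} \<in> edges (half_power G) \<longleftrightarrow> e \<in> edges G \<and> v \<in> e"
  "{Inr e, Inl v} \<in> edges (half_power G) \<longleftrightarrow> e \<in> edges G \<and> v \<in> e"
  "{Inl v, Inl w} \<notin> edges (half_power G)"
  "{Inr e, Inr f} \<notin> edges (half_power G)"
  unfolding half_power_def by (auto simp: doubleton_eq_iff)

lemma half_power_edgeE:
  assumes "s \<in> edges (half_power G)"
  obtains v e where "s = {Inl v, Inr e}" "e \<in> edges G" "v \<in> e"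
  using assms unfolding half_power_def by auto

lemma half_power_automorphism_edge:
  assumes "simple_graph G" "graph_automorphism (half_power G) f" "e \<in> edges G" "v \<in> e"
  shows "{f (Inl v), f (Inr e)} \<in> edges (half_power G)"
proof -
  have "v \<in> verts G" using assms(1,3,4) unfolding simple_graph_def by blast
  then have "Inl v \<in> verts (half_power G)" "Inr e \<in> verts (half_power G)"
    "{Inl v, Inr e} \<in> edges (half_power G)"
    using assms(3,4) by simp_all
  then show ?thesis
    using assms(2) unfolding graph_automorphism_def by blast
qed

text \<open>One vertex of \<open>G\<close> sent to the edge side drags all others along. If
  \<open>f (Inl v) = Inr g\<close>, then \<open>f\<close> carries the edges at \<open>v\<close>
  bijectively to the two ends of \<open>g\<close>; so all degrees are 2 and \<open>G\<close> is a
  cycle.\<close>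

lemma half_power_automorphism_preserves_sides:
  assumes G: "simple_graph G" "connected_graph G" "\<not> cycle_graph G"
    and f: "graph_automorphism (half_power G) f"
    and u: "u \<in> verts G"
  shows "f (Inl u) \<in> range Inl"
proof (rule ccontr)
  let ?H = "half_power G"
  note edge = half_power_automorphism_edge[OF G(1) f]
  have bij: "bij_betw f (verts ?H) (verts ?H)"
    and iff: "\<And>x y. x \<in> verts ?H \<Longrightarrow> y \<in> verts ?H \<Longrightarrow> {x, y} \<in> edges ?H \<longleftrightarrow> {f x, f y} \<in> edges ?H"
    using f unfolding graph_automorphism_def by auto
  assume "f (Inl u) \<notin> range Inl"
  \<comment> \<open>Every edge of the half power joins the two sides, and so does its image.\<close>
  moreover have opp: "f (Inl v) \<in> range Inl \<longleftrightarrow> f (Inr e) \<notin> range Inl"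
    if "e \<in> edges G" "v \<in> e" for v e
    using edge[OF that] by (cases "f (Inl v)"; cases "f (Inr e)") auto
  ultimately have "verts G \<subseteq> {v. f (Inl v) \<notin> range Inl}"
    using opp by (intro connected_graph_closed[OF G(2) u]) blast+
  then have swap: "\<exists>e. f (Inl v) = Inr e" if "v \<in> verts G" for v
    using that by (cases "f (Inl v)") auto
  have "card {e \<in> edges G. v \<in> e} = 2" if v: "v \<in> verts G" for v
  proof -
    obtain g where g: "f (Inl v) = Inr g" using swap[OF v] by blast
    have Hv: "Inl v \<in> verts ?H" using v by simp
    then have "Inr g \<in> verts ?H" using bij g by (metis bij_betwE)
    then have gE: "g \<in> edges G" by simp
    have eq: "(f \<circ> Inr) ` {e \<in> edges G. v \<in> e} = Inl ` g"
    proof (intro equalityI subsetI)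
      fix x assume "x \<in> (f \<circ> Inr) ` {e \<in> edges G. v \<in> e}"
      then obtain e where "e \<in> edges G" "v \<in> e" "x = f (Inr e)" by auto
      then have "{Inr g, x} \<in> edges ?H" using edge[of e v] g by simp
      then show "x \<in> Inl ` g" by (cases x) simp_all
    next
      fix x :: "'a + 'a set" assume "x \<in> Inl ` g"
      then obtain w where w: "x = Inl w" "w \<in> g" by blast
      then have "x \<in> verts ?H"
        using G(1) gE unfolding simple_graph_def by auto
      \<comment> \<open>The preimage of an end of \<open>g\<close> is adjacent to
        \<open>Inl v\<close>, because \<open>f\<close> reflects adjacency; hence it is an edge at
        \<open>v\<close>.\<close>
      then obtain z where z: "z \<in> verts ?H" "x = f z"
        using bij by (metis bij_betw_def imageE)
      have "{f (Inl v), f z} \<in> edges ?H"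
        using g gE w z(2) by (metis edges_half_power(2))
      then have "{Inl v, z} \<in> edges ?H" using iff[OF Hv z(1)] by blast
      then show "x \<in> (f \<circ> Inr) ` {e \<in> edges G. v \<in> e}"
        using z(2) by (cases z) auto
    qed
    have "inj_on (f \<circ> Inr) {e \<in> edges G. v \<in> e}"
    proof (rule comp_inj_on)
      show "inj_on f (Inr ` {e \<in> edges G. v \<in> e})"
        by (rule inj_on_subset[OF bij_betw_imp_inj_on[OF bij]]) auto
    qed simp
    then have "card {e \<in> edges G. v \<in> e} = card ((f \<circ> Inr) ` {e \<in> edges G. v \<in> e})"
      by (simp only: card_image)
    also have "\<dots> = card g"
      unfolding eq by (simp add: card_image)
    also have "\<dots> = 2"
      using G(1) gE unfolding simple_graph_def by blast
    finally show ?thesis .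
  qed
  then show False
    using connected_two_regular_cycle_graph[OF G(1,2)] G(3) by blast
qed

text \<open>A subdivision vertex is determined by its two neighbours, so the action \<open>h\<close>
  on the original vertices forces the action on the edges.\<close>

lemma half_power_automorphism_induced:
  assumes G: "simple_graph G" "connected_graph G" "\<not> cycle_graph G"
    and f: "graph_automorphism (half_power G) f"
  obtains h where "graph_automorphism G h"
    "\<And>v. v \<in> verts G \<Longrightarrow> f (Inl v) = Inl (h v)"
    "\<And>e. e \<in> edges G \<Longrightarrow> f (Inr e) = Inr (h ` e)"
proof -
  let ?H = "half_power G"
  note edge = half_power_automorphism_edge[OF G(1) f]
  have bij: "bij_betw f (verts ?H) (verts ?H)"
    and iff: "\<And>x y. x \<in> verts ?H \<Longrightarrow> y \<in> verts ?H \<Longrightarrow> {x, y} \<in> edges ?H \<longleftrightarrow> {f x, f y} \<in> edges ?H"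
    using f unfolding graph_automorphism_def by auto
  define h where "h v = projl (f (Inl v))" for v
  have fl: "f (Inl v) = Inl (h v)" if "v \<in> verts G" for v
    using half_power_automorphism_preserves_sides[OF G f that] unfolding h_def by auto
  have into: "h v \<in> verts G" if "v \<in> verts G" for v
    using bij_betwE[OF bij] that fl[OF that] by (metis verts_half_power(1))
  have inj: "inj_on h (verts G)"
  proof (rule inj_onI)
    fix x y assume *: "x \<in> verts G" "y \<in> verts G" "h x = h y"
    then have "f (Inl x) = f (Inl y)" by (simp add: fl)
    then show "x = y"
      using inj_onD[OF bij_betw_imp_inj_on[OF bij], of "Inl x" "Inl y"] * by simp
  qed
  have fr: "h ` e \<in> edges G \<and> f (Inr e) = Inr (h ` e)" if e: "e \<in> edges G" for e
  proof -
    obtain u v where uv: "e = {u, v}" "u \<noteq> v" "u \<in> verts G" "v \<in> verts G"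
      using simple_graph_edgeE[OF G(1) e] .
    have *: "{Inl (h u), f (Inr e)} \<in> edges ?H" "{Inl (h v), f (Inr e)} \<in> edges ?H"
      using edge[OF e, of u] edge[OF e, of v] uv by (simp_all add: fl)
    then obtain g where g: "f (Inr e) = Inr g" by (cases "f (Inr e)") auto
    then have "g \<in> edges G" "h u \<in> g" "h v \<in> g" using * by auto
    moreover have "h u \<noteq> h v" using inj uv by (auto dest: inj_onD)
    ultimately have "g = {h u, h v}" using simple_graph_edge_eqI[OF G(1)] by blast
    then show ?thesis using g \<open>g \<in> edges G\<close> uv(1) by simp
  qed
  have "graph_automorphism G h"
    unfolding graph_automorphism_def
  proof (intro conjI ballI iffI)
    have "finite (verts G)" using G(1) unfolding simple_graph_def by blast
    then show "bij_betw h (verts G) (verts G)"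
      using inj into by (simp add: bij_betw_def endo_inj_surj image_subsetI)
  next
    fix u v assume "{u, v} \<in> edges G"
    then show "{h u, h v} \<in> edges G" using fr by fastforce
  next
    fix u v assume uv: "u \<in> verts G" "v \<in> verts G" and g: "{h u, h v} \<in> edges G"
    then have "Inr {h u, h v} \<in> verts ?H" by simp
    \<comment> \<open>Adjacency is reflected by pulling back the middle vertex of the image edge:
      its preimage lies on the edge side, since \<open>f\<close> keeps \<open>Inl\<close> vertices
      there, and it is joined to both \<open>u\<close> and \<open>v\<close>.\<close>
    then obtain z where z: "z \<in> verts ?H" "f z = Inr {h u, h v}"
      using bij by (metis bij_betw_def imageE)
    then obtain e where e: "z = Inr e"
      using fl by (cases z) auto
    have "{f (Inl u), f z} \<in> edges ?H" "{f (Inl v), f z} \<in> edges ?H"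
      using g uv z(2) by (simp_all add: fl)
    then have "{Inl u, z} \<in> edges ?H" "{Inl v, z} \<in> edges ?H"
      using iff z(1) uv by simp_all
    then have *: "e \<in> edges G" "u \<in> e" "v \<in> e" unfolding e by auto
    have "u \<noteq> v" using simple_graph_edgeD(1)[OF G(1) g] by blast
    then show "{u, v} \<in> edges G" using simple_graph_edge_eqI[OF G(1) *] * by simp
  qed
  then show thesis using that fl fr by blast
qed

section \<open>Labels of half edges from colours of edges\<close>

text \<open>The encoding \<open>p\<close> sends colours to pairs \<open>(j, i)\<close> with \<open>1 \<le> i \<le> j \<le> k\<close>, that is, to multisets of
  two labels.\<close>

lemma half_power_labeling:
  assumes G: "simple_graph G" "connected_graph G" "\<not> cycle_graph G"
    and c: "distinguishing_labeling G d c"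
    and p: "inj_on p {1..d}" "p ` {1..d} \<subseteq> (SIGMA j:{1..k}. {1..j})"
  shows "\<exists>c'. distinguishing_labeling (half_power G) k c'"
proof -
  let ?H = "half_power G"
  \<comment> \<open>One end of each edge, chosen arbitrarily, carries the first member of the pair.
    An automorphism may violate this choice, so only the set of the two labels is compared
    below.\<close>
  define l where "l v e = (if v = (SOME u. u \<in> e) then fst (p (c e)) else snd (p (c e)))" for v e
  \<comment> \<open>An edge of the half power has exactly one \<open>Inl\<close> and one
    \<open>Inr\<close> member, so both descriptions denote.\<close>
  define c' where "c' s = l (THE v. Inl v \<in> s) (THE e. Inr e \<in> s)" for s
  have c'_eq: "c' {Inl v, Inr e} = l v e" for v e
    unfolding c'_def by simp
  have cr: "c e \<in> {1..d}" if "e \<in> edges G" for e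
    using c that unfolding distinguishing_labeling_def by blast
  then have pr: "p (c e) \<in> (SIGMA j:{1..k}. {1..j})" if "e \<in> edges G" for e
    using p(2) that by blast
  have l_img: "(\<lambda>v. l v e) ` e = {fst (p (c e)), snd (p (c e))}" if "e \<in> edges G" for e
  proof -
    obtain u v where uv: "e = {u, v}" "u \<noteq> v" using simple_graph_edgeE[OF G(1) \<open>e \<in> edges G\<close>] .
    define a where "a = (SOME u. u \<in> e)"
    have "a \<in> e" unfolding a_def some_in_eq using uv(1) by simp
    then have "a = u \<or> a = v" using uv(1) by simp
    moreover have "l w e = (if w = a then fst (p (c e)) else snd (p (c e)))" for w
      unfolding l_def a_def ..
    ultimately show ?thesis using uv(2) by (auto simp: uv(1))
  qed
  have "c' s \<in> {1..k}" if s: "s \<in> edges ?H" for s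
  proof -
    obtain v e where "s = {Inl v, Inr e}" "e \<in> edges G"
      using half_power_edgeE[OF s] by metis
    then show ?thesis using pr[of e] unfolding l_def by (auto simp: c'_eq l_def)
  qed
  moreover have False
    if f: "graph_automorphism ?H f" "preserves_labeling ?H c' f" and x: "x \<in> verts ?H" "f x \<noteq> x"
    for f x
  proof -
    obtain h where h: "graph_automorphism G h"
      and fl: "\<And>v. v \<in> verts G \<Longrightarrow> f (Inl v) = Inl (h v)"
      and fr: "\<And>e. e \<in> edges G \<Longrightarrow> f (Inr e) = Inr (h ` e)"
      using half_power_automorphism_induced[OF G f(1)] by blast
    have "c (h ` e) = c e" if e: "e \<in> edges G" for e
    proof -
      have "e \<subseteq> verts G" using G(1) e unfolding simple_graph_def by blast
      have he: "h ` e \<in> edges G"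
        using bij_betwE[of f "verts ?H" "verts ?H"] f(1) fr[OF e] e
        unfolding graph_automorphism_def by (metis verts_half_power(2))
      have "l (h v) (h ` e) = l v e" if "v \<in> e" for v
      proof -
        have "{Inl v, Inr e} \<in> edges ?H" using that e by simp
        then have "c' (f ` {Inl v, Inr e}) = c' {Inl v, Inr e}"
          using f(2) unfolding preserves_labeling_def by blast
        then show ?thesis
          using that \<open>e \<subseteq> verts G\<close> e by (simp add: fl fr c'_eq subset_iff)
      qed
      then have "(\<lambda>v. l v (h ` e)) ` (h ` e) = (\<lambda>v. l v e) ` e"
        by (simp add: image_image)
      then have "{fst (p (c (h ` e))), snd (p (c (h ` e)))} = {fst (p (c e)), snd (p (c e))}"
        using l_img[OF e] l_img[OF he] by simp
      \<comment> \<open>The order convention recovers a pair from the set of its members, as maximum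
        and minimum; a repeated label shows as a singleton.\<close>
      moreover have "snd (p (c e)) \<le> fst (p (c e))" "snd (p (c (h ` e))) \<le> fst (p (c (h ` e)))"
        using pr[OF e] pr[OF he] by auto
      ultimately have "p (c (h ` e)) = p (c e)"
        by (auto simp: doubleton_eq_iff prod_eq_iff)
      then show ?thesis using p(1) cr[OF e] cr[OF he] by (auto dest: inj_onD)
    qed
    \<comment> \<open>So \<open>h\<close> preserves the distinguishing labeling
      \<open>c\<close>.\<close>
    then have triv: "h v = v" if "v \<in> verts G" for v
      using c h that unfolding distinguishing_labeling_def preserves_labeling_def by blast
    show False
    proof (cases x)
      case (Inl v)
      then show ?thesis using x fl[of v] triv[of v] by simp
    next
      case (Inr e)
      then have "e \<in> edges G" using x by simp
      then have "h ` e = e" using triv G(1) unfolding simple_graph_def by (force simp: subset_iff)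
      then show ?thesis using Inr x fr[of e] \<open>e \<in> edges G\<close> by simp
    qed
  qed
  ultimately have "distinguishing_labeling ?H k c'"
    unfolding distinguishing_labeling_def by blast
  then show ?thesis by blast
qed

theorem theorem4p2:
  fixes G :: "'a graph"
  assumes "simple_graph G"
    and "connected_graph G"
    and "card (verts G) \<ge> 3"
    and "\<not> cycle_graph G"
  shows "int (distinguishing_index (half_power G))
           \<le> \<lceil>(- 1 + sqrt (1 + 8 * real (distinguishing_index G))) / 2\<rceil>"
proof -
  define d where "d = distinguishing_index G"
  define r where "r = (- 1 + sqrt (1 + 8 * real d)) / 2"
  define k where "k = nat \<lceil>r\<rceil>"
  obtain c where c: "distinguishing_labeling G d c"
    using distinguishing_index_attained[OF assms(1-3)] unfolding d_def .
  \<comment> \<open>The square root is at least 1; hence \<open>nat\<close> does not truncate the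
    ceiling.\<close>
  have "r \<ge> 0" unfolding r_def by simp
  then have k: "int k = \<lceil>r\<rceil>" unfolding k_def by simp
  \<comment> \<open>Since \<open>r\<close> is the nonnegative root of
    \<open>x * (x + 1) = 2 * d\<close>, this inequality amounts to
    \<open>2 * d \<le> k * (k + 1)\<close>.\<close>
  then have "r \<le> real k" by linarith
  then have "sqrt (1 + 8 * real d) \<le> 2 * real k + 1" unfolding r_def by simp
  then have "1 + 8 * real d \<le> (2 * real k + 1)\<^sup>2" by (rule sqrt_le_D)
  then have "2 * real d \<le> real k * (real k + 1)" by (simp add: power2_eq_square algebra_simps)
  then have "real (2 * d) \<le> real (k * (k + 1))" by (simp add: algebra_simps)
  then have "2 * d \<le> k * (k + 1)" by (simp only: of_nat_le_iff)
  \<comment> \<open>The multisets of two labels are counted by a triangular number, doubled to avoid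
    division.\<close>
  moreover have "2 * card (SIGMA j:{1..m}. {1..j}) = m * (m + 1)" for m :: nat
    by (induction m) auto
  note this[of k]
  ultimately have "card {1..d} \<le> card (SIGMA j:{1..k}. {1..j})" by simp
  then obtain p where "p ` {1..d} \<subseteq> (SIGMA j:{1..k}. {1..j})" "inj_on p {1..d}"
    using card_le_inj[of "{1..d}" "SIGMA j:{1..k}. {1..j}"] by auto
  then have "\<exists>c'. distinguishing_labeling (half_power G) k c'"
    using half_power_labeling[OF assms(1,2,4) c] by blast
  then have "distinguishing_index (half_power G) \<le> k"
    unfolding distinguishing_index_def by (rule Least_le)
  then show ?thesis using k unfolding r_def d_def by linarith
qed

end
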